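(* Let $n, L, d, \mu, m \geq 2$ with $m$ an integer, let $\eta\in (0,1)$ and $\varepsilon\in (0,\frac{1}{8}]$, and suppose that $L = \frac{2^{10} \log n}{\eta^2}$ and $d \ge \frac{2^{135} m^8 \mu^{9} (\log n)^7}{\eta^{14}}$. Let $G$ be a properly edge-coloured bipartite $(d, \eta, \varepsilon)$-expander on $n$ vertices with maximum degree at most $\mu d$, and let $Z$ be a set of $m$ vertices of $G$. Then $G$ contains a rainbow $K_m$-subdivision rooted at $Z$, where every edge of $K_m$ is subdivided at most $L$ times.
   Context: Logarithms are in base 2. For a graph $G$, $d(G)=2e(G)/|V(G)|$ is its average degree, and for $S\subseteq V(G)$, $d(S)$ denotes the average degree of the induced subgraph $G[S]$. A graph $G$ is $d$-minimal if $d(G)\ge d$ but $d(H)<d$ for every proper subgraph $H\subseteq G$. Given $d\ge 1$, $\eta\in(0,1)$, $\varepsilon\in(0,\frac12]$, an $n$-vertex graph $G$ is a $(d,\eta,\varepsilon)$-expander if $G$ is $d$-minimal and every $S\subseteq V(G)$ with $|S|\le(1-\varepsilon)n$ satisfies $d(S)\le(1-\eta)d$. A proper edge-colouring gives distinct colours to edges sharing a vertex; a subgraph is rainbow if its edges have distinct colours. For a set $Z$ of $m$ vertices, a $K_m$-subdivision rooted at $Z$ is a subgraph consisting of $\binom{m}{2}$ paths, each joining a different pair of distinct vertices of $Z$, whose interiors are pairwise vertex-disjoint and disjoint from $Z$; an edge is subdivided at most $L$ times if its path has at most $L$ internal vertices. *)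

theory Defs
  imports Complex_Main
begin

section \<open>Finite simple graphs\<close>

record 'a ugraph =
  verts :: "'a set"
  edges :: "'a set set"

definition simple_graph :: "'a ugraph \<Rightarrow> bool" where
  "simple_graph G \<longleftrightarrow> finite (verts G) \<and> (\<forall>e\<in>edges G. e \<subseteq> verts G \<and> card e = 2)"

definition subgraph :: "'a ugraph \<Rightarrow> 'a ugraph \<Rightarrow> bool" where
  "subgraph H G \<longleftrightarrow> simple_graph H \<and> verts H \<subseteq> verts G \<and> edges H \<subseteq> edges G"

definition induced :: "'a ugraph \<Rightarrow> 'a set \<Rightarrow> 'a ugraph" where
  "induced G S = \<lparr>verts = S, edges = {e \<in> edges G. e \<subseteq> S}\<rparr>"

definition vertex_degree :: "'a ugraph \<Rightarrow> 'a \<Rightarrow> nat" where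
  "vertex_degree G v = card {e \<in> edges G. v \<in> e}"

text \<open>Only meaningful for finite graphs with at least one vertex.\<close>
definition max_degree :: "'a ugraph \<Rightarrow> nat" where
  "max_degree G = Max (vertex_degree G ` verts G)"

text \<open>Division by zero gives the graph without vertices average degree 0.  In the two
  definitions below this makes the conditions on the empty vertex set hold automatically
  whenever \<open>d > 0\<close> and \<open>\<eta> \<le> 1\<close>.\<close>
definition avg_degree :: "'a ugraph \<Rightarrow> real" where
  "avg_degree G = 2 * real (card (edges G)) / real (card (verts G))"

definition minimal_graph :: "real \<Rightarrow> 'a ugraph \<Rightarrow> bool" where
  "minimal_graph d G \<longleftrightarrow>
     avg_degree G \<ge> d \<and> (\<forall>H. subgraph H G \<and> H \<noteq> G \<longrightarrow> avg_degree H < d)"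

definition expander :: "real \<Rightarrow> real \<Rightarrow> real \<Rightarrow> 'a ugraph \<Rightarrow> bool" where
  "expander d \<eta> \<epsilon> G \<longleftrightarrow>
     minimal_graph d G \<and>
     (\<forall>S. S \<subseteq> verts G \<and> real (card S) \<le> (1 - \<epsilon>) * real (card (verts G)) \<longrightarrow>
        avg_degree (induced G S) \<le> (1 - \<eta>) * d)"

definition bipartite :: "'a ugraph \<Rightarrow> bool" where
  "bipartite G \<longleftrightarrow>
     (\<exists>A B. A \<union> B = verts G \<and> A \<inter> B = {} \<and> (\<forall>e\<in>edges G. \<exists>a\<in>A. \<exists>b\<in>B. e = {a, b}))"

section \<open>Edge-colourings\<close>

definition proper_edge_colouring :: "'a ugraph \<Rightarrow> ('a set \<Rightarrow> 'c) \<Rightarrow> bool" where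
  "proper_edge_colouring G c \<longleftrightarrow>
     (\<forall>e\<in>edges G. \<forall>f\<in>edges G. e \<noteq> f \<and> e \<inter> f \<noteq> {} \<longrightarrow> c e \<noteq> c f)"

definition rainbow :: "('a set \<Rightarrow> 'c) \<Rightarrow> 'a ugraph \<Rightarrow> bool" where
  "rainbow c H \<longleftrightarrow> inj_on c (edges H)"

section \<open>Paths and rooted subdivisions\<close>

text \<open>A path is the list of its vertices in order.\<close>

definition path_edges :: "'a list \<Rightarrow> 'a set set" where
  "path_edges p = {{p ! i, p ! Suc i} | i. Suc i < length p}"

definition path_interior :: "'a list \<Rightarrow> 'a set" where
  "path_interior p = set (butlast (tl p))"

definition is_path :: "'a ugraph \<Rightarrow> 'a list \<Rightarrow> bool" where
  "is_path G p \<longleftrightarrow> p \<noteq> [] \<and> distinct p \<and> set p \<subseteq> verts G \<and> path_edges p \<subseteq> edges G"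

definition vertex_pairs :: "'a set \<Rightarrow> 'a set set" where
  "vertex_pairs Z = {e. e \<subseteq> Z \<and> card e = 2}"

text \<open>\<open>H\<close> is a subdivision, rooted at \<open>Z\<close>, of the complete graph on \<open>Z\<close>; the edge \<open>e\<close> of
  that complete graph is replaced by the path \<open>P e\<close>, listed in either direction.\<close>
definition rooted_subdivision :: "'a set \<Rightarrow> ('a set \<Rightarrow> 'a list) \<Rightarrow> 'a ugraph \<Rightarrow> bool" where
  "rooted_subdivision Z P H \<longleftrightarrow>
     (\<forall>e\<in>vertex_pairs Z. is_path H (P e) \<and> {hd (P e), last (P e)} = e \<and> path_interior (P e) \<inter> Z = {}) \<and>
     (\<forall>e\<in>vertex_pairs Z. \<forall>f\<in>vertex_pairs Z. e \<noteq> f \<longrightarrow> path_interior (P e) \<inter> path_interior (P f) = {}) \<and>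
     verts H = Z \<union> (\<Union>e\<in>vertex_pairs Z. set (P e)) \<and>
     edges H = (\<Union>e\<in>vertex_pairs Z. path_edges (P e))"

end

theory Submission
  imports Defs
begin

text \<open>
  Process the pairs of \<open>Z\<close> greedily; at each stage only few vertices \<open>W\<close> and few colours \<open>K\<close>
  are already used, so it suffices to join two vertices \<open>x\<close>, \<open>y\<close> by a short rainbow path
  avoiding \<open>W\<close> and \<open>K\<close>.  Choose a uniformly random set \<open>C\<close> of colours and grow from \<open>x\<close> with
  colours in \<open>C\<close>, from \<open>y\<close> with colours outside \<open>C\<close>.  If each side reaches more than half of the
  vertices with probability more than \<open>1/2\<close>, the two reached sets meet for some \<open>C\<close>, and the two
  halves cannot share a colour.

  To analyse one side, write \<open>C\<close> as a union of \<open>l\<close> independent random sets, each containing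
  a colour with probability \<open>p\<close> where \<open>(1 - p)\<^sup>l = 1/2\<close>, and reveal them one by one.  By minimality
  at least \<open>d\<bar>B\<bar>/2\<close> edges touch the set \<open>B\<close> reached so far.  Either many of them lead to outside
  vertices with few neighbours in \<open>B\<close>; then these vertices are so numerous that a small
  proportion of them suffices.  Or the outside vertices with many neighbours in \<open>B\<close> number at
  least \<open>\<eta>\<bar>B\<bar>/2\<close>, because \<open>G\<close> is an expander, and each of them is very likely to be hit.
  Each vertex of \<open>B\<close> refuses the colours on its own path from \<open>x\<close>, which keeps the paths rainbow
  and costs few edges.
\<close>

section \<open>Random sets of colours\<close>

text \<open>The expectation of \<open>g\<close> at a random subset of \<open>F\<close> that contains each element independently
  with probability \<open>p\<close>.\<close>
definition rand_avg :: "real \<Rightarrow> 'c set \<Rightarrow> ('c set \<Rightarrow> real) \<Rightarrow> real" where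
  "rand_avg p F g = (\<Sum>Q\<in>Pow F. p ^ card Q * (1 - p) ^ card (F - Q) * g Q)"

lemma rand_avg_empty [simp]: "rand_avg p {} g = g {}"
  by (simp add: rand_avg_def)

lemma rand_avg_insert:
  assumes "finite F" "a \<notin> F"
  shows "rand_avg p (insert a F) g
    = (1 - p) * rand_avg p F g + p * rand_avg p F (\<lambda>Q. g (insert a Q))"
proof -
  let ?t = "\<lambda>Q. p ^ card Q * (1 - p) ^ card (insert a F - Q) * g Q"
  have inj: "inj_on (insert a) (Pow F)"
    using assms(2) by (intro inj_onI) (metis Pow_iff insert_ident subsetD)
  have disj: "Pow F \<inter> insert a ` Pow F = {}"
    using assms(2) by auto
  have "rand_avg p (insert a F) g = sum ?t (Pow F) + sum ?t (insert a ` Pow F)"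
    unfolding rand_avg_def Pow_insert using assms(1) disj by (intro sum.union_disjoint) auto
  also have "sum ?t (Pow F) = (\<Sum>Q\<in>Pow F. (1 - p) * (p ^ card Q * (1 - p) ^ card (F - Q) * g Q))"
  proof (rule sum.cong)
    fix Q assume Q: "Q \<in> Pow F"
    then have "insert a F - Q = insert a (F - Q)" using assms(2) by auto
    moreover have "card (insert a (F - Q)) = Suc (card (F - Q))" using assms by simp
    ultimately show "?t Q = (1 - p) * (p ^ card Q * (1 - p) ^ card (F - Q) * g Q)" by simp
  qed simp
  also have "\<dots> = (1 - p) * rand_avg p F g"
    by (simp add: rand_avg_def sum_distrib_left)
  also have "sum ?t (insert a ` Pow F) = (\<Sum>Q\<in>Pow F. ?t (insert a Q))"
    using inj by (simp add: sum.reindex)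
  also have "\<dots> = (\<Sum>Q\<in>Pow F. p * (p ^ card Q * (1 - p) ^ card (F - Q) * g (insert a Q)))"
  proof (rule sum.cong)
    fix Q assume Q: "Q \<in> Pow F"
    then have "finite Q" "a \<notin> Q" using assms by (auto intro: finite_subset)
    moreover have "insert a F - insert a Q = F - Q" using assms(2) by auto
    ultimately show "?t (insert a Q) = p * (p ^ card Q * (1 - p) ^ card (F - Q) * g (insert a Q))"
      by simp
  qed simp
  also have "\<dots> = p * rand_avg p F (\<lambda>Q. g (insert a Q))"
    by (simp add: rand_avg_def sum_distrib_left)
  finally show ?thesis .
qed

lemma rand_avg_mono:
  assumes "0 \<le> p" "p \<le> 1" "\<And>Q. Q \<subseteq> F \<Longrightarrow> g Q \<le> h Q"
  shows "rand_avg p F g \<le> rand_avg p F h"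
  unfolding rand_avg_def using assms by (intro sum_mono mult_left_mono) auto

lemma rand_avg_add: "rand_avg p F (\<lambda>Q. g Q + h Q) = rand_avg p F g + rand_avg p F h"
  by (simp add: rand_avg_def distrib_left sum.distrib)

lemma rand_avg_cmult: "rand_avg p F (\<lambda>Q. k * g Q) = k * rand_avg p F g"
  by (simp add: rand_avg_def sum_distrib_left mult.left_commute)

lemma rand_avg_sum: "rand_avg p F (\<lambda>Q. \<Sum>w\<in>A. g w Q) = (\<Sum>w\<in>A. rand_avg p F (g w))"
  unfolding rand_avg_def by (simp add: sum_distrib_left sum.swap[of _ A])

lemma rand_avg_const [simp]: "finite F \<Longrightarrow> rand_avg p F (\<lambda>_. k) = k"
  by (induction F rule: finite_induct) (auto simp: rand_avg_insert algebra_simps)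

text \<open>A colour misses two independent sets of densities \<open>p\<close> and \<open>q\<close>
  with probability \<open>(1 - p) * (1 - q)\<close>, independently of other colours. This permits
  revealing the colours in rounds.\<close>

lemma rand_avg_union:
  assumes "finite F"
  shows "rand_avg (p + q - p * q) F g = rand_avg p F (\<lambda>C. rand_avg q F (\<lambda>Q. g (C \<union> Q)))"
  using assms
proof (induction F arbitrary: g rule: finite_induct)
  case (insert a F)
  then show ?case
    by (simp add: rand_avg_insert rand_avg_add rand_avg_cmult) (simp add: algebra_simps)
qed simp

text \<open>At density 1/2 a set and its complement have equal weight, so one estimate serves both
  the colours in \<open>C\<close> and those outside.\<close>

lemma rand_avg_compl:
  assumes "finite F"
  shows "rand_avg (1/2) F (\<lambda>Q. g (F - Q)) = rand_avg (1/2) F g"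
proof -
  have "(\<Sum>Q\<in>Pow F. (1/2) ^ card (F - Q) * (1/2) ^ card (F - (F - Q)) * g (F - Q))
      = (\<Sum>Q\<in>Pow F. (1/2::real) ^ card Q * (1/2) ^ card (F - Q) * g Q)"
    by (rule sum.reindex_bij_witness[where i = "\<lambda>Q. F - Q" and j = "\<lambda>Q. F - Q"]) auto
  moreover have "(\<Sum>Q\<in>Pow F. (1/2) ^ card (F - Q) * (1/2) ^ card (F - (F - Q)) * g (F - Q))
      = (\<Sum>Q\<in>Pow F. (1/2::real) ^ card Q * (1/2) ^ card (F - Q) * g (F - Q))"
    by (rule sum.cong) (auto simp: double_diff)
  ultimately show ?thesis by (simp add: rand_avg_def)
qed

text \<open>Independence makes the average factor over the colours. Factors 0 and 1 give avoidance
  probabilities; exponentials give a Chernoff-type bound.\<close>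

lemma rand_avg_prod:
  fixes u :: "'c \<Rightarrow> real"
  assumes "finite F"
  shows "rand_avg p F (\<lambda>Q. \<Prod>a\<in>Q. u a) = (\<Prod>a\<in>F. 1 - p + p * u a)"
  using assms
proof (induction F rule: finite_induct)
  case (insert a F)
  have "rand_avg p F (\<lambda>Q. \<Prod>x\<in>insert a Q. u x) = rand_avg p F (\<lambda>Q. u a * (\<Prod>x\<in>Q. u x))"
    unfolding rand_avg_def
  proof (intro sum.cong refl)
    fix Q assume "Q \<in> Pow F"
    then have "finite Q" "a \<notin> Q" using insert.hyps by (auto intro: finite_subset)
    then show "p ^ card Q * (1 - p) ^ card (F - Q) * (\<Prod>x\<in>insert a Q. u x) =
         p ^ card Q * (1 - p) ^ card (F - Q) * (u a * (\<Prod>x\<in>Q. u x))" by simp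
  qed
  then show ?case
    using insert by (simp add: rand_avg_insert rand_avg_cmult algebra_simps)
qed simp

section \<open>Tail bounds for random colour sets\<close>

lemma exp_minus_le_inverse: "0 < y \<Longrightarrow> exp (- y) \<le> 1 / (y::real)"
  using exp_ge_add_one_self[of y] by (simp add: exp_minus field_simps del: exp_ge_add_one_self)

lemma rand_avg_avoid:
  assumes "finite F" "S \<subseteq> F"
  shows "rand_avg p F (\<lambda>Q. of_bool (S \<inter> Q = {})) = (1 - p) ^ card S"
proof -
  have "rand_avg p F (\<lambda>Q. of_bool (S \<inter> Q = {})) = rand_avg p F (\<lambda>Q. \<Prod>a\<in>Q. of_bool (a \<notin> S))"
    unfolding rand_avg_def
  proof (intro sum.cong refl)
    fix Q assume "Q \<in> Pow F"
    then have "finite Q" using assms by (auto intro: finite_subset)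
    then have "(\<Prod>a\<in>Q. of_bool (a \<notin> S)) = (of_bool (S \<inter> Q = {}) :: real)"
      by (induction Q rule: finite_induct) auto
    then show "p ^ card Q * (1 - p) ^ card (F - Q) * of_bool (S \<inter> Q = {}) =
         p ^ card Q * (1 - p) ^ card (F - Q) * (\<Prod>a\<in>Q. of_bool (a \<notin> S))" by simp
  qed
  also have "\<dots> = (\<Prod>a\<in>F. 1 - p + p * of_bool (a \<notin> S))"
    using assms by (simp add: rand_avg_prod)
  also have "\<dots> = (\<Prod>a\<in>F. if a \<in> S then 1 - p else 1)"
    by (intro prod.cong) auto
  also have "\<dots> = (1 - p) ^ card S"
    using assms by (simp add: prod.If_cases Int_absorb1)
  finally show ?thesis .
qed

text \<open>Markov's inequality for the number of missed sets: each \<open>S w\<close> is missed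
  with probability at most \<open>1 / (p * T)\<close>, and on the bad event more than half of
  \<open>N\<close> is missed.\<close>

lemma rand_avg_few_hits_large:
  fixes p T :: real
  assumes "finite F" "finite N" "0 < p" "p \<le> 1" "0 < T"
    and S: "\<And>w. w \<in> N \<Longrightarrow> S w \<subseteq> F \<and> T \<le> card (S w)"
  shows "rand_avg p F (\<lambda>Q. of_bool (2 * card {w\<in>N. S w \<inter> Q \<noteq> {}} < card N)) \<le> 2 / (p * T)"
proof (cases "N = {}")
  case True
  then show ?thesis using assms by simp
next
  case False
  then have N: "0 < real (card N)" using assms by (simp add: card_gt_0_iff)
  have miss: "rand_avg p F (\<lambda>Q. of_bool (S w \<inter> Q = {})) \<le> 1 / (p * T)" if "w \<in> N" for w
  proof -
    have "rand_avg p F (\<lambda>Q. of_bool (S w \<inter> Q = {})) = (1 - p) ^ card (S w)"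
      using S[OF that] assms by (intro rand_avg_avoid) auto
    also have "\<dots> \<le> exp (- p) ^ card (S w)"
      using assms exp_ge_add_one_self[of "- p"] by (intro power_mono) auto
    also have "\<dots> = exp (- (p * card (S w)))"
      by (simp add: exp_of_nat_mult[symmetric] mult.commute)
    also have "\<dots> \<le> exp (- (p * T))" using S[OF that] assms by simp
    also have "\<dots> \<le> 1 / (p * T)" using assms by (intro exp_minus_le_inverse) simp
    finally show ?thesis .
  qed
  have "rand_avg p F (\<lambda>Q. of_bool (2 * card {w\<in>N. S w \<inter> Q \<noteq> {}} < card N))
      \<le> rand_avg p F (\<lambda>Q. 2 / card N * (\<Sum>w\<in>N. of_bool (S w \<inter> Q = {})))"
  proof (rule rand_avg_mono)
    fix Q
    have "N = {w\<in>N. S w \<inter> Q \<noteq> {}} \<union> {w\<in>N. S w \<inter> Q = {}}" by auto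
    then have "card N = card {w\<in>N. S w \<inter> Q \<noteq> {}} + card {w\<in>N. S w \<inter> Q = {}}"
      using assms(2) by (subst card_Un_disjoint[symmetric]) auto
    moreover have "(\<Sum>w\<in>N. of_bool (S w \<inter> Q = {})) = real (card {w\<in>N. S w \<inter> Q = {}})"
      using assms(2) by (simp add: of_bool_def sum.If_cases Int_def)
    ultimately show "of_bool (2 * card {w\<in>N. S w \<inter> Q \<noteq> {}} < card N)
        \<le> 2 / real (card N) * (\<Sum>w\<in>N. of_bool (S w \<inter> Q = {}))"
      using N by (auto simp: field_simps of_bool_def)
  qed (use assms in auto)
  also have "\<dots> = 2 / card N * (\<Sum>w\<in>N. rand_avg p F (\<lambda>Q. of_bool (S w \<inter> Q = {})))"
    by (simp only: rand_avg_cmult rand_avg_sum)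
  also have "\<dots> \<le> 2 / card N * (\<Sum>w\<in>N. 1 / (p * T))"
    using miss by (intro mult_left_mono sum_mono) auto
  also have "\<dots> = 2 / (p * T)" using N by simp
  finally show ?thesis .
qed

text \<open>Hits are dependent when colours repeat, so they are grouped by colour: the count is a
  sum of independent terms of size at most \<open>b\<close>, and an exponential moment bounds its
  lower tail.\<close>

lemma rand_avg_few_hits_bounded_multiplicity:
  fixes p :: real and b :: nat
  assumes "finite F" "finite N" "0 < p" "p \<le> 1" "0 < b" "N \<noteq> {}"
    and col: "col ` N \<subseteq> F"
    and mult: "\<And>a. card {w\<in>N. col w = a} \<le> b"
  shows "rand_avg p F (\<lambda>Q. of_bool (card {w\<in>N. col w \<in> Q} < b)) \<le> 6 * b / (p * card N)"
proof -
  \<comment> \<open>Scaling by \<open>b\<close> puts every weight in [0,1]; the bad event says that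
    the chosen colours have total weight below 1.\<close>
  define t where "t a = real (card {w\<in>N. col w = a}) / b" for a
  have t: "0 \<le> t a" "t a \<le> 1" for a
    using mult[of a] assms(5) by (auto simp: t_def)
  have sum_t: "(\<Sum>a\<in>Q. t a) = card {w\<in>N. col w \<in> Q} / b" if "Q \<subseteq> F" for Q
  proof -
    have "finite Q" using that assms by (auto intro: finite_subset)
    moreover have "{w\<in>N. col w \<in> Q} = (\<Union>a\<in>Q. {w\<in>N. col w = a})" by auto
    ultimately have "card {w\<in>N. col w \<in> Q} = (\<Sum>a\<in>Q. card {w\<in>N. col w = a})"
      using assms(2) by (simp, subst card_UN_disjoint) auto
    then show ?thesis by (simp add: t_def sum_divide_distrib)
  qed
  have "{w\<in>N. col w \<in> F} = N" using col by auto
  then have sum_F: "(\<Sum>a\<in>F. t a) = card N / b" using sum_t[of F] by simp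
  \<comment> \<open>On [0,1], exp(-t) \<le> 1/(1+t) \<le> 1 - t/2; then 1 - s \<le> exp(-s) makes
    each factor exponential again.\<close>
  have factor: "1 - p + p * exp (- t a) \<le> exp (- (p * t a / 2))" for a
  proof -
    have "exp (- t a) \<le> 1 / (1 + t a)"
      using exp_ge_add_one_self[of "t a"] t[of a] by (simp add: exp_minus field_simps)
    also have "\<dots> \<le> 1 - t a / 2"
    proof -
      have "t a * t a \<le> t a" using t[of a] by (simp add: mult_left_le)
      then show ?thesis using t[of a] by (simp add: field_simps)
    qed
    finally have "p * exp (- t a) \<le> p * (1 - t a / 2)" using assms by simp
    then have "1 - p + p * exp (- t a) \<le> 1 + (- (p * t a / 2))" by (simp add: algebra_simps)
    then show ?thesis using exp_ge_add_one_self[of "- (p * t a / 2)"] by linarith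
  qed
  \<comment> \<open>Exponential moment: \<open>\<Prod>a\<in>Q. exp (- t a)\<close> is at least \<open>1/3\<close> on the bad event.\<close>
  have "rand_avg p F (\<lambda>Q. of_bool (card {w\<in>N. col w \<in> Q} < b))
      \<le> rand_avg p F (\<lambda>Q. 3 * (\<Prod>a\<in>Q. exp (- t a)))"
  proof (rule rand_avg_mono)
    fix Q assume Q: "Q \<subseteq> F"
    then have fin: "finite Q" using assms by (auto intro: finite_subset)
    have pr: "(\<Prod>a\<in>Q. exp (- t a)) = exp (- (card {w\<in>N. col w \<in> Q} / b))"
      using sum_t[OF Q] fin by (simp add: exp_sum[symmetric] sum_negf)
    show "of_bool (card {w\<in>N. col w \<in> Q} < b) \<le> 3 * (\<Prod>a\<in>Q. exp (- t a))"
    proof (cases "card {w\<in>N. col w \<in> Q} < b")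
      case True
      then have "exp (- 1) \<le> exp (- (card {w\<in>N. col w \<in> Q} / b))" by simp
      moreover have "1 / 3 \<le> exp (- 1 :: real)"
        using exp_le by (simp add: exp_minus field_simps)
      ultimately have "1 \<le> 3 * exp (- (card {w\<in>N. col w \<in> Q} / b))" by linarith
      then show ?thesis unfolding pr using True by simp
    qed (simp add: pr)
  qed (use assms in auto)
  also have "\<dots> = 3 * (\<Prod>a\<in>F. 1 - p + p * exp (- t a))"
    using assms by (simp only: rand_avg_cmult rand_avg_prod)
  also have "\<dots> \<le> 3 * (\<Prod>a\<in>F. exp (- (p * t a / 2)))"
    using factor assms by (intro mult_left_mono prod_mono) (auto intro!: add_nonneg_nonneg)
  also have "(\<Prod>a\<in>F. exp (- (p * t a / 2))) = exp (- (p * (\<Sum>a\<in>F. t a) / 2))"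
    using assms(1) by (simp add: exp_sum[symmetric] sum_negf sum_distrib_left sum_divide_distrib)
  also have "\<dots> = exp (- (p * card N / (2 * b)))" by (simp add: sum_F)
  also have "3 * \<dots> \<le> 3 * (1 / (p * card N / (2 * b)))"
    using assms by (intro mult_left_mono exp_minus_le_inverse) (auto simp: card_gt_0_iff)
  also have "\<dots> = 6 * b / (p * card N)" by simp
  finally show ?thesis .
qed

section \<open>One step of expansion\<close>

lemma finite_edges: "simple_graph G \<Longrightarrow> finite (edges G)"
  by (rule finite_subset[of _ "Pow (verts G)"]) (auto simp: simple_graph_def)

lemma edges_induced_le:
  assumes "simple_graph G" "S \<subseteq> verts G" "avg_degree (induced G S) \<le> k"
  shows "2 * real (card {e\<in>edges G. e \<subseteq> S}) \<le> k * card S"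
proof (cases "S = {}")
  case True
  then have "{e\<in>edges G. e \<subseteq> S} = {}"
    using assms(1) by (auto simp: simple_graph_def)
  then show ?thesis using True by simp
next
  case False
  then have "0 < card S"
    using assms by (auto simp: simple_graph_def card_gt_0_iff intro: finite_subset)
  then show ?thesis using assms(3) by (simp add: avg_degree_def induced_def field_simps)
qed

text \<open>Deleting \<open>B\<close> leaves a proper subgraph, hence at most \<open>d / 2\<close>
  edges per remaining vertex, while \<open>G\<close> has at least \<open>d / 2\<close> per vertex;
  the difference touches \<open>B\<close>.\<close>

lemma minimal_graph_edges_touching:
  assumes G: "simple_graph G" and min: "minimal_graph d G" and B: "B \<subseteq> verts G" "B \<noteq> {}"
  shows "d * card B \<le> 2 * real (card {e\<in>edges G. e \<inter> B \<noteq> {}})"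
proof -
  have finV: "finite (verts G)" using G by (simp add: simple_graph_def)
  have B0: "0 < card B" "card B \<le> card (verts G)"
    using B finV by (auto simp: card_gt_0_iff card_mono intro: finite_subset)
  let ?S = "verts G - B"
  have "subgraph (induced G ?S) G"
    using G by (auto simp: subgraph_def simple_graph_def induced_def)
  moreover have "verts (induced G ?S) \<noteq> verts G"
    using B by (auto simp: induced_def)
  ultimately have "avg_degree (induced G ?S) \<le> d"
    using min by (auto simp: minimal_graph_def less_imp_le)
  then have "2 * real (card {e\<in>edges G. e \<subseteq> ?S}) \<le> d * card ?S"
    using G by (intro edges_induced_le) auto
  moreover have "real (card ?S) = real (card (verts G)) - card B"
    using B finV B0 by (simp add: card_Diff_subset finite_subset of_nat_diff)
  moreover have "d * card (verts G) \<le> 2 * card (edges G)"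
  proof -
    have "d \<le> 2 * card (edges G) / card (verts G)"
      using min by (simp add: minimal_graph_def avg_degree_def)
    then show ?thesis using B0 by (simp add: pos_le_divide_eq)
  qed
  moreover have "card (edges G) = card {e\<in>edges G. e \<inter> B \<noteq> {}} + card {e\<in>edges G. e \<subseteq> ?S}"
  proof -
    have "card {e\<in>edges G. e \<inter> B \<noteq> {}} + card {e\<in>edges G. e \<subseteq> ?S}
        = card ({e\<in>edges G. e \<inter> B \<noteq> {}} \<union> {e\<in>edges G. e \<subseteq> ?S})"
      using finite_edges[OF G] by (intro card_Un_disjoint[symmetric]) auto
    also have "{e\<in>edges G. e \<inter> B \<noteq> {}} \<union> {e\<in>edges G. e \<subseteq> ?S} = edges G"
      using G by (auto simp: simple_graph_def)
    finally show ?thesis ..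
  qed
  ultimately show ?thesis by (simp add: algebra_simps)
qed

lemma proper_edge_colouring_inj:
  assumes "proper_edge_colouring G c" "{v, w} \<in> edges G" "{v', w} \<in> edges G" "c {v, w} = c {v', w}"
  shows "v = v'"
proof (rule ccontr)
  assume "v \<noteq> v'"
  then have "{v, w} \<noteq> {v', w}" by (auto simp: doubleton_eq_iff)
  then have "c {v, w} \<noteq> c {v', w}"
    using assms(1)[unfolded proper_edge_colouring_def, rule_format, OF assms(2,3)] by auto
  then show False using assms(4) by simp
qed

text \<open>\<open>Fb v\<close> is the set of colours refused by \<open>v\<close>.\<close>
definition nbrs_via :: "'a ugraph \<Rightarrow> ('a set \<Rightarrow> 'c) \<Rightarrow> 'a set \<Rightarrow> ('a \<Rightarrow> 'c set) \<Rightarrow> 'a set \<Rightarrow> 'c set \<Rightarrow> 'a set" where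
  "nbrs_via G c W Fb B Q = {w. w \<notin> W \<and> (\<exists>v\<in>B. {v, w} \<in> edges G \<and> c {v, w} \<in> Q - Fb v)}"

text \<open>The edges touching \<open>B\<close> are covered by those within
  \<open>B \<union> Nhi\<close> (\<open>E1\<close>), those leading to \<open>Nlo\<close>
  (\<open>E2\<close>), and those lost to refused colours or to \<open>W\<close> (\<open>E3\<close>).
  The losses are small, so either \<open>Nlo\<close> is far larger than \<open>B\<close>, or
  sparsity of \<open>B \<union> Nhi\<close> forces \<open>Nhi\<close> to be large.\<close>

lemma random_colours_expand:
  fixes d \<eta> \<epsilon> p T \<delta> :: real and D :: nat
  assumes G: "simple_graph G" and col: "proper_edge_colouring G c" and ex: "expander d \<eta> \<epsilon> G"
    and par: "\<epsilon> \<le> 1/8" "0 < \<eta>" "\<eta> < 1" "0 < d" "0 < p" "p \<le> 1" "0 < T"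
    and B: "B \<subseteq> verts G" "B \<noteq> {}" "2 * card B \<le> card (verts G)"
    and forb: "\<And>v. v \<in> B \<Longrightarrow> finite (Fb v) \<and> card (Fb v) \<le> a" "finite W" "a + card W \<le> D"
    and D: "8 * real D \<le> \<eta> * d"
    and \<delta>: "2 / (p * T) \<le> \<delta>" "48 * T / (p * \<eta> * d) \<le> \<delta>"
  shows "rand_avg p (c ` edges G)
      (\<lambda>Q. of_bool (real (card (B \<union> nbrs_via G c W Fb B Q)) < (1 + \<eta> / 4) * card B)) \<le> \<delta>"
proof -
  define F where "F = c ` edges G"
  have finE: "finite (edges G)" and finF: "finite F" and finV: "finite (verts G)" and finB: "finite B"
    using finite_edges[OF G] G B by (auto simp: F_def simple_graph_def intro: finite_subset)
  have edge: "v \<in> verts G" "w \<in> verts G" "v \<noteq> w" if "{v, w} \<in> edges G" for v w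
    using G that by (auto simp: simple_graph_def card_insert_if split: if_splits)
  have B0: "0 < card B" using B finB by (simp add: card_gt_0_iff)
  \<comment> \<open>\<open>U w\<close> holds the neighbours in \<open>B\<close> that accept the
    colour of their edge to \<open>w\<close>. Properness makes these colours distinct, so
    \<open>S w\<close> has the same size.\<close>
  define U where "U w = {v\<in>B. {v, w} \<in> edges G \<and> c {v, w} \<notin> Fb v}" for w
  define S where "S w = (\<lambda>v. c {v, w}) ` U w" for w
  define M where "M = {w\<in>verts G - B - W. U w \<noteq> {}}"
  define Nhi where "Nhi = {w\<in>M. T \<le> card (S w)}"
  define Nlo where "Nlo = {w\<in>M. card (S w) < T}"
  have fin: "finite M" "finite Nhi" "finite Nlo" "\<And>w. finite (U w)"
    using finV finB by (auto simp: M_def Nhi_def Nlo_def U_def)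
  have cardS: "card (S w) = card (U w)" for w
    unfolding S_def
    by (intro card_image inj_onI, rule proper_edge_colouring_inj[OF col, where w = w])
      (auto simp: U_def)
  have SF: "S w \<subseteq> F" for w by (auto simp: S_def U_def F_def)
  have hit: "w \<in> nbrs_via G c W Fb B Q" if "w \<in> M" "S w \<inter> Q \<noteq> {}" for w Q
    using that by (auto simp: nbrs_via_def M_def S_def U_def)
  have nbrs_sub: "nbrs_via G c W Fb B Q \<subseteq> verts G" for Q
    using edge by (auto simp: nbrs_via_def)
  have grow: "card B + card X \<le> card (B \<union> nbrs_via G c W Fb B Q)"
    if "X \<subseteq> M" "\<And>w. w \<in> X \<Longrightarrow> S w \<inter> Q \<noteq> {}" for X Q
  proof -
    have "card B + card X = card (B \<union> X)"
      using that(1) fin(1) finB by (subst card_Un_disjoint) (auto simp: M_def intro: finite_subset)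
    also have "\<dots> \<le> card (B \<union> nbrs_via G c W Fb B Q)"
      using that hit finB finite_subset[OF nbrs_sub finV] by (intro card_mono) auto
    finally show ?thesis .
  qed
  define E1 where "E1 = {e\<in>edges G. e \<subseteq> B \<union> Nhi}"
  define E2 where "E2 = (\<Union>w\<in>Nlo. (\<lambda>v. {v, w}) ` U w)"
  define E3 where "E3 = (\<Union>v\<in>B. {e\<in>edges G. v \<in> e \<and> c e \<in> Fb v} \<union> (\<lambda>w. {v, w}) ` W)"
  have touch: "{e\<in>edges G. e \<inter> B \<noteq> {}} \<subseteq> E1 \<union> E2 \<union> E3"
  proof
    fix e assume "e \<in> {e\<in>edges G. e \<inter> B \<noteq> {}}"
    then obtain v where e: "e \<in> edges G" "v \<in> e" "v \<in> B" by auto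
    moreover from e(1) G obtain x y where "e = {x, y}" "x \<noteq> y"
      unfolding simple_graph_def by (metis card_2_iff)
    ultimately obtain w where w: "e = {v, w}" by auto
    consider "w \<in> W" | "c e \<in> Fb v" | "w \<notin> W" "c e \<notin> Fb v" "w \<in> B"
      | "w \<notin> W" "c e \<notin> Fb v" "w \<notin> B" by blast
    then show "e \<in> E1 \<union> E2 \<union> E3"
    proof cases
      case 4
      then have U: "v \<in> U w" using e w by (auto simp: U_def)
      then have "w \<in> M" using 4 e w edge by (auto simp: M_def)
      then have "w \<in> Nhi \<or> w \<in> Nlo" by (auto simp: Nhi_def Nlo_def)
      then show ?thesis using U e w by (auto simp: E1_def E2_def)
    qed (use e w in \<open>auto simp: E1_def E3_def\<close>)
  qed
  have E2: "real (card E2) \<le> T * card Nlo"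
  proof -
    have "card E2 \<le> (\<Sum>w\<in>Nlo. card ((\<lambda>v. {v, w}) ` U w))"
      unfolding E2_def using fin by (intro card_UN_le)
    also have "\<dots> \<le> (\<Sum>w\<in>Nlo. card (S w))"
      unfolding cardS using fin by (intro sum_mono card_image_le)
    finally have "real (card E2) \<le> (\<Sum>w\<in>Nlo. real (card (S w)))"
      by (metis of_nat_le_iff of_nat_sum)
    also have "\<dots> \<le> (\<Sum>w\<in>Nlo. T)" by (intro sum_mono) (auto simp: Nlo_def)
    finally show ?thesis by (simp add: mult.commute)
  qed
  \<comment> \<open>Properness gives each \<open>v\<close> in \<open>B\<close> at most one edge per
    refused colour, and at most one edge leads to each vertex of \<open>W\<close>.\<close>
  have E3: "card E3 \<le> D * card B"
  proof -
    have "card ({e\<in>edges G. v \<in> e \<and> c e \<in> Fb v} \<union> (\<lambda>w. {v, w}) ` W) \<le> D" if "v \<in> B" for v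
    proof -
      have "card {e\<in>edges G. v \<in> e \<and> c e \<in> Fb v} \<le> card (Fb v)"
      proof (rule card_inj_on_le[of c])
        show "inj_on c {e\<in>edges G. v \<in> e \<and> c e \<in> Fb v}"
          using col by (auto simp: inj_on_def proper_edge_colouring_def)
      qed (use forb that in auto)
      moreover have "card ((\<lambda>w. {v, w}) ` W) \<le> card W" using forb by (intro card_image_le)
      ultimately show ?thesis
        using forb(1)[OF that] forb(3) card_Un_le[of "{e\<in>edges G. v \<in> e \<and> c e \<in> Fb v}" "(\<lambda>w. {v, w}) ` W"]
        by linarith
    qed
    then have "card E3 \<le> (\<Sum>v\<in>B. D)"
      unfolding E3_def by (intro order.trans[OF card_UN_le[OF finB]] sum_mono)
    then show ?thesis by (simp add: mult.commute)
  qed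
  have "card {e\<in>edges G. e \<inter> B \<noteq> {}} \<le> card (E1 \<union> E2 \<union> E3)"
    using touch finE fin finB forb by (intro card_mono) (auto simp: E1_def E2_def E3_def)
  also have "\<dots> \<le> card E1 + card E2 + card E3"
    by (meson card_Un_le add_mono le_refl order.trans)
  finally have "real (card {e\<in>edges G. e \<inter> B \<noteq> {}}) \<le> real (card E1) + card E2 + card E3"
    by (metis of_nat_add of_nat_le_iff)
  moreover have "d * card B \<le> 2 * real (card {e\<in>edges G. e \<inter> B \<noteq> {}})"
    using ex B G by (intro minimal_graph_edges_touching) (auto simp: expander_def)
  moreover have "real (card E3) \<le> \<eta> * d / 8 * card B"
  proof -
    have "real (card E3) \<le> real D * card B" using E3 by (metis of_nat_le_iff of_nat_mult)
    also have "\<dots> \<le> \<eta> * d / 8 * card B" using D by (intro mult_right_mono) auto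
    finally show ?thesis .
  qed
  ultimately have main: "d * card B \<le> 2 * card E1 + 2 * (T * card Nlo) + \<eta> * d / 4 * card B"
    using E2 by linarith
  \<comment> \<open>In the first case |Nlo| \<ge> \<eta> d |B| / (8T), which turns 6|B| / (p |Nlo|)
    into 48T / (p \<eta> d). In the second, \<open>E2\<close> and \<open>E3\<close> together cost
    less than \<eta> d |B| / 2 in \<open>main\<close>.\<close>
  show ?thesis unfolding F_def[symmetric]
  proof (cases "\<eta> * d / 8 * card B \<le> T * card Nlo")
    case True
    have "0 < \<eta> * d / 8 * card B" using par B0 by simp
    then have Nlo: "0 < card Nlo" using True par by (cases "card Nlo = 0") auto
    \<comment> \<open>One usable neighbour per vertex suffices: \<open>w\<close> is reached as soon
      as the single colour \<open>k w\<close> is chosen.\<close>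
    define v where "v w = (SOME u. u \<in> U w)" for w
    have v: "v w \<in> U w" if "w \<in> Nlo" for w
      using that unfolding v_def by (auto simp: Nlo_def M_def some_in_eq)
    define k where "k w = c {v w, w}" for w
    have kS: "k w \<in> S w" if "w \<in> Nlo" for w using v[OF that] by (auto simp: S_def k_def)
    \<comment> \<open>Each colour class is a matching, so it meets \<open>B\<close> in at most \<open>card B\<close> edges.\<close>
    have mult: "card {w\<in>Nlo. k w = x} \<le> card B" for x
    proof (rule card_inj_on_le[of v])
      show "inj_on v {w\<in>Nlo. k w = x}"
      proof (rule inj_onI)
        fix w w' assume *: "w \<in> {w\<in>Nlo. k w = x}" "w' \<in> {w\<in>Nlo. k w = x}" "v w = v w'"
        then have "{w, v w} \<in> edges G" "{w', v w} \<in> edges G" "c {w, v w} = c {w', v w}"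
          using v[of w] v[of w'] by (auto simp: U_def k_def insert_commute)
        then show "w = w'" by (rule proper_edge_colouring_inj[OF col])
      qed
    qed (use finB v in \<open>auto simp: U_def\<close>)
    have "rand_avg p F (\<lambda>Q. of_bool (real (card (B \<union> nbrs_via G c W Fb B Q)) < (1 + \<eta> / 4) * card B))
        \<le> rand_avg p F (\<lambda>Q. of_bool (card {w\<in>Nlo. k w \<in> Q} < card B))"
    proof (rule rand_avg_mono)
      fix Q
      have "card B + card {w\<in>Nlo. k w \<in> Q} \<le> card (B \<union> nbrs_via G c W Fb B Q)"
        using kS by (intro grow) (auto simp: Nlo_def)
      \<comment> \<open>As \<eta> < 1, gaining \<open>card B\<close> vertices already exceeds the
        required growth.\<close>
      moreover have "(1 + \<eta> / 4) * card B \<le> 2 * real (card B)" using par by (intro mult_right_mono) auto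
      ultimately have "real (card (B \<union> nbrs_via G c W Fb B Q)) < (1 + \<eta> / 4) * card B
          \<Longrightarrow> card {w\<in>Nlo. k w \<in> Q} < card B" by linarith
      then show "of_bool (real (card (B \<union> nbrs_via G c W Fb B Q)) < (1 + \<eta> / 4) * card B)
          \<le> (of_bool (card {w\<in>Nlo. k w \<in> Q} < card B) :: real)" by (simp add: of_bool_def)
    qed (use par in auto)
    also have "\<dots> \<le> 6 * card B / (p * card Nlo)"
      using finF fin par B0 Nlo mult subsetD[OF SF kS]
      by (intro rand_avg_few_hits_bounded_multiplicity) auto
    also have "\<dots> \<le> 48 * T / (p * \<eta> * d)"
    proof -
      have "p * 48 * (\<eta> * d / 8 * card B) \<le> p * 48 * (T * card Nlo)"
        using par True by (intro mult_left_mono) auto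
      then show ?thesis using par Nlo by (simp add: field_simps)
    qed
    finally show "rand_avg p F (\<lambda>Q. of_bool (real (card (B \<union> nbrs_via G c W Fb B Q)) < (1 + \<eta> / 4) * card B)) \<le> \<delta>"
      using \<delta> by linarith
  next
    case False
    have Nhi: "\<eta> / 2 * card B \<le> card Nhi"
    proof (cases "real (card (B \<union> Nhi)) \<le> (1 - \<epsilon>) * card (verts G)")
      case True
      have sub: "B \<union> Nhi \<subseteq> verts G" using B by (auto simp: Nhi_def M_def)
      have cBN: "card (B \<union> Nhi) = card B + card Nhi"
        using finB fin by (intro card_Un_disjoint) (auto simp: Nhi_def M_def)
      \<comment> \<open>Sparsity bounds 2|E1| by (1 - \<eta>) d (|B| + |Nhi|), while the count gives
        2|E1| > (1 - \<eta>/2) d |B|; comparing them isolates |Nhi|.\<close>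
      have "avg_degree (induced G (B \<union> Nhi)) \<le> (1 - \<eta>) * d"
        using ex True sub by (auto simp: expander_def)
      then have "2 * real (card E1) \<le> (1 - \<eta>) * d * (real (card B) + card Nhi)"
        using edges_induced_le[OF G sub] cBN by (simp add: E1_def)
      then have "d * card B < (1 - \<eta>) * d * (real (card B) + card Nhi) + \<eta> * d / 2 * card B"
        using main False by linarith
      then have "d * (\<eta> / 2 * card B) < d * ((1 - \<eta>) * card Nhi)" by (simp add: algebra_simps)
      then have "\<eta> / 2 * card B < (1 - \<eta>) * card Nhi" using par by simp
      also have "\<dots> \<le> 1 * real (card Nhi)" using par by (intro mult_right_mono) auto
      finally show ?thesis by simp
    next
      case False
      \<comment> \<open>Sparsity says nothing about so large a set, but then |Nhi| > 7n/8 - |B|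
        \<ge> 3|B|/4, because 2|B| \<le> n.\<close>
      have "(7/8) * real (card (verts G)) \<le> (1 - \<epsilon>) * card (verts G)"
        using par by (intro mult_right_mono) auto
      moreover have "card (B \<union> Nhi) \<le> card B + card Nhi" by (rule card_Un_le)
      moreover have "\<eta> / 2 * card B \<le> 1 / 2 * card B" using par by (intro mult_right_mono) auto
      ultimately show ?thesis using False B(3) by linarith
    qed
    have "rand_avg p F (\<lambda>Q. of_bool (real (card (B \<union> nbrs_via G c W Fb B Q)) < (1 + \<eta> / 4) * card B))
        \<le> rand_avg p F (\<lambda>Q. of_bool (2 * card {w\<in>Nhi. S w \<inter> Q \<noteq> {}} < card Nhi))"
    proof (rule rand_avg_mono)
      fix Q
      have "card B + card {w\<in>Nhi. S w \<inter> Q \<noteq> {}} \<le> card (B \<union> nbrs_via G c W Fb B Q)"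
        by (intro grow) (auto simp: Nhi_def)
      moreover have "(1 + \<eta> / 4) * card B = card B + \<eta> / 2 * card B / 2" by (simp add: algebra_simps)
      ultimately have "real (card (B \<union> nbrs_via G c W Fb B Q)) < (1 + \<eta> / 4) * card B
          \<Longrightarrow> 2 * card {w\<in>Nhi. S w \<inter> Q \<noteq> {}} < card Nhi" using Nhi by linarith
      then show "of_bool (real (card (B \<union> nbrs_via G c W Fb B Q)) < (1 + \<eta> / 4) * card B)
          \<le> (of_bool (2 * card {w\<in>Nhi. S w \<inter> Q \<noteq> {}} < card Nhi) :: real)" by (simp add: of_bool_def)
    qed (use par in auto)
    also have "\<dots> \<le> 2 / (p * T)"
      using finF fin par SF by (intro rand_avg_few_hits_large) (auto simp: Nhi_def)
    finally show "rand_avg p F (\<lambda>Q. of_bool (real (card (B \<union> nbrs_via G c W Fb B Q)) < (1 + \<eta> / 4) * card B)) \<le> \<delta>"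
      using \<delta> by linarith
  qed
qed

section \<open>Rainbow paths between two vertices\<close>

definition linked :: "'a set set \<Rightarrow> 'a \<Rightarrow> 'a \<Rightarrow> bool" where
  "linked E x y \<longleftrightarrow> (x, y) \<in> {(a, b). {a, b} \<in> E}\<^sup>*"

lemma linked_mono: "linked E x y \<Longrightarrow> E \<subseteq> E' \<Longrightarrow> linked E' x y"
  unfolding linked_def by (erule rtrancl_mono[THEN subsetD, rotated]) auto

lemma linked_sym: "linked E x y \<Longrightarrow> linked E y x"
  unfolding linked_def by (rule symD[OF sym_rtrancl]) (auto simp: sym_def insert_commute)

lemma linked_trans: "linked E x y \<Longrightarrow> linked E y z \<Longrightarrow> linked E x z"
  unfolding linked_def by (rule rtrancl_trans)

lemma linked_edge: "{x, y} \<in> E \<Longrightarrow> linked E x y"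
  unfolding linked_def by (intro r_into_rtrancl) simp

lemma linked_end: "linked E x y \<Longrightarrow> y = x \<or> y \<in> \<Union>E"
  unfolding linked_def by (erule rtranclE) auto

lemma path_edges_snoc:
  assumes "p \<noteq> []"
  shows "path_edges (p @ [z]) = insert {last p, z} (path_edges p)"
proof -
  have "path_edges (p @ [z]) = (\<lambda>i. {(p @ [z]) ! i, (p @ [z]) ! Suc i}) ` {..<length p}"
    by (auto simp: path_edges_def)
  also have "{..<length p} = insert (length p - 1) {i. Suc i < length p}"
    using assms by (cases p) auto
  also have "(\<lambda>i. {(p @ [z]) ! i, (p @ [z]) ! Suc i}) ` \<dots> = insert {last p, z} (path_edges p)"
    using assms by (auto simp: path_edges_def nth_append last_conv_nth)
  finally show ?thesis .
qed

lemma path_edges_singleton [simp]: "path_edges [x] = {}"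
  by (simp add: path_edges_def)

lemma path_edges_append_left: "path_edges p \<subseteq> path_edges (p @ q)"
proof
  fix e assume "e \<in> path_edges p"
  then obtain i where "e = {p ! i, p ! Suc i}" "Suc i < length p" by (auto simp: path_edges_def)
  then have "e = {(p @ q) ! i, (p @ q) ! Suc i}" "Suc i < length (p @ q)" by (auto simp: nth_append)
  then show "e \<in> path_edges (p @ q)" unfolding path_edges_def by blast
qed

text \<open>Induction along the chain of edges: when the next vertex already lies on the path, the
  path is cut off there, so vertices never repeat.\<close>

lemma linked_imp_path:
  assumes "linked E x y"
  shows "\<exists>p. p \<noteq> [] \<and> hd p = x \<and> last p = y \<and> distinct p \<and> path_edges p \<subseteq> E"
  using assms unfolding linked_def
proof (induction rule: rtrancl_induct)
  case base
  show ?case by (intro exI[of _ "[x]"]) simp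
next
  case (step y z)
  then obtain p where p: "p \<noteq> []" "hd p = x" "last p = y" "distinct p" "path_edges p \<subseteq> E"
    by auto
  show ?case
  proof (cases "z \<in> set p")
    case True
    then obtain us vs where us: "p = (us @ [z]) @ vs" by (auto simp: in_set_conv_decomp)
    then have "path_edges (us @ [z]) \<subseteq> E" using p(5) path_edges_append_left by blast
    moreover have "hd (us @ [z]) = x" using us p(2) by (cases us) auto
    ultimately show ?thesis using us p(4) by (intro exI[of _ "us @ [z]"]) auto
  next
    case False
    then show ?thesis using p step.hyps by (intro exI[of _ "p @ [z]"]) (auto simp: path_edges_snoc)
  qed
qed

lemma path_edges_subset_Pow: "path_edges p \<subseteq> Pow (set p)"
  by (auto simp: path_edges_def intro: nth_mem)

lemma finite_path_edges [simp]: "finite (path_edges p)"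
  using path_edges_subset_Pow by (rule finite_subset) simp

text \<open>Every appended vertex is new, and so is its edge. This turns a bound on the number of
  edges into one on the length of the path.\<close>

lemma length_le_card_path_edges: "distinct p \<Longrightarrow> length p \<le> Suc (card (path_edges p))"
proof (induction p rule: rev_induct)
  case (snoc z p)
  show ?case
  proof (cases "p = []")
    case False
    have "{last p, z} \<notin> path_edges p"
      using snoc.prems path_edges_subset_Pow[of p] by auto
    then show ?thesis using snoc False by (simp add: path_edges_snoc)
  qed simp
qed simp

lemma set_path_subset: "p \<noteq> [] \<Longrightarrow> set p \<subseteq> insert (hd p) (\<Union>(path_edges p))"
proof (induction p rule: rev_induct)
  case (snoc z p)
  then show ?case by (cases "p = []") (auto simp: path_edges_snoc)
qed simp

lemma path_interior_subset:
  assumes "distinct p" "p \<noteq> []" "hd p \<noteq> last p"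
  shows "path_interior p \<subseteq> set p - {hd p, last p}"
proof -
  obtain x r where r: "p = x # r" using assms by (cases p) auto
  moreover from this assms obtain q y where "r = q @ [y]" by (cases r rule: rev_cases) auto
  ultimately have p: "p = x # q @ [y]" by simp
  then have "path_interior p = set q" by (simp add: path_interior_def)
  then show ?thesis using p assms(1) by auto
qed

text \<open>Rainbow connections are recorded as edge sets with distinct colours rather than as walks;
  genuine paths are extracted only at the very end.\<close>
definition reach ::
  "'a ugraph \<Rightarrow> ('a set \<Rightarrow> 'c) \<Rightarrow> 'a set \<Rightarrow> 'c set \<Rightarrow> 'a \<Rightarrow> nat \<Rightarrow> 'c set \<Rightarrow> 'a set" where
  "reach G c W K x i C = {v. \<exists>E\<subseteq>edges G. card E \<le> i \<and> inj_on c E \<and> c ` E \<subseteq> C - K \<and>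
     \<Union>E \<inter> W = {} \<and> linked E x v}"

section \<open>Growth of the reachable sets\<close>

lemma reach_mono:
  assumes "i \<le> j" "C \<subseteq> C'"
  shows "reach G c W K x i C \<subseteq> reach G c W K x j C'"
proof
  fix v assume "v \<in> reach G c W K x i C"
  then obtain E where "E \<subseteq> edges G" "card E \<le> i" "inj_on c E" "c ` E \<subseteq> C - K"
    "\<Union>E \<inter> W = {}" "linked E x v" by (auto simp: reach_def)
  then show "v \<in> reach G c W K x j C'"
    unfolding reach_def using assms by (intro CollectI exI[of _ E]) auto
qed

lemma start_in_reach: "x \<in> reach G c W K x i C"
  unfolding reach_def linked_def by (auto intro!: exI[of _ "{}"])

lemma reach_subset_verts:
  assumes "simple_graph G" "x \<in> verts G"
  shows "reach G c W K x i C \<subseteq> verts G"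
proof
  fix v assume "v \<in> reach G c W K x i C"
  then obtain E where E: "E \<subseteq> edges G" "linked E x v" by (auto simp: reach_def)
  then show "v \<in> verts G" using linked_end[OF E(2)] assms by (auto simp: simple_graph_def)
qed

text \<open>Each reached vertex fixes one witnessing edge set and refuses its colours together with
  \<open>K\<close>; any other colour keeps the enlarged set rainbow. The refusals are fixed before
  \<open>Q\<close> is drawn, so they do not spoil the randomness.\<close>

lemma reach_extend:
  assumes G: "simple_graph G" and x: "x \<notin> W" and K: "finite K"
  obtains Fb where "\<And>v. v \<in> reach G c W K x i C \<Longrightarrow> finite (Fb v) \<and> card (Fb v) \<le> i + card K"
    and "\<And>Q. nbrs_via G c W Fb (reach G c W K x i C) Q \<subseteq> reach G c W K x (Suc i) (C \<union> Q)"
proof -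
  let ?P = "\<lambda>v E. E \<subseteq> edges G \<and> card E \<le> i \<and> inj_on c E \<and> c ` E \<subseteq> C - K \<and>
     \<Union>E \<inter> W = {} \<and> linked E x v"
  define Ev where "Ev v = (SOME E. ?P v E)" for v
  have Ev: "?P v (Ev v)" if "v \<in> reach G c W K x i C" for v
    using that unfolding reach_def Ev_def by (intro someI_ex[of "?P v"]) auto
  define Fb where "Fb v = c ` Ev v \<union> K" for v
  have fin: "finite (Ev v)" if "v \<in> reach G c W K x i C" for v
    using Ev[OF that] finite_edges[OF G] by (auto intro: finite_subset)
  show ?thesis
  proof
    fix v assume v: "v \<in> reach G c W K x i C"
    have "card (Fb v) \<le> card (c ` Ev v) + card K" unfolding Fb_def by (rule card_Un_le)
    also have "\<dots> \<le> i + card K" using card_image_le[OF fin[OF v], of c] Ev[OF v] by auto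
    finally show "finite (Fb v) \<and> card (Fb v) \<le> i + card K"
      using fin[OF v] K by (simp add: Fb_def)
  next
    fix Q
    show "nbrs_via G c W Fb (reach G c W K x i C) Q \<subseteq> reach G c W K x (Suc i) (C \<union> Q)"
    proof
      fix w assume "w \<in> nbrs_via G c W Fb (reach G c W K x i C) Q"
      then obtain v where v: "v \<in> reach G c W K x i C" "w \<notin> W" "{v, w} \<in> edges G"
        "c {v, w} \<in> Q" "c {v, w} \<notin> c ` Ev v" "c {v, w} \<notin> K"
        by (auto simp: nbrs_via_def Fb_def)
      let ?E = "insert {v, w} (Ev v)"
      note E = Ev[OF v(1)]
      have "v \<notin> W" using linked_end[of "Ev v" x v] E x by auto
      moreover have "card ?E \<le> Suc i" using E fin[OF v(1)] by (simp add: card_insert_if)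
      moreover have "linked ?E x v" using E by (auto intro: linked_mono)
      then have "linked ?E x w" by (rule linked_trans) (simp add: linked_edge)
      moreover have "inj_on c ?E" using E v(5) by (auto simp: inj_on_insert)
      ultimately show "w \<in> reach G c W K x (Suc i) (C \<union> Q)"
        unfolding reach_def using E v by (intro CollectI exI[of _ ?E]) auto
    qed
  qed
qed

text \<open>The random \<open>C\<close> is a union of \<open>i\<close> independent sets of density
  \<open>p\<close>. Failure after a round means earlier failure or a failed growth step, at a cost
  of \<delta> per round. Passing half of the vertices counts as success, since growth is only
  guaranteed up to there.\<close>

lemma random_reach_large:
  fixes d \<eta> \<epsilon> p T \<delta> :: real and l D :: nat
  assumes G: "simple_graph G" and col: "proper_edge_colouring G c" and ex: "expander d \<eta> \<epsilon> G"
    and par: "\<epsilon> \<le> 1/8" "0 < \<eta>" "\<eta> < 1" "0 < d" "0 < p" "p \<le> 1" "0 < T"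
    and x: "x \<in> verts G" "x \<notin> W" and fin: "finite W" "finite K"
    and D: "l + card K + card W \<le> D" "8 * real D \<le> \<eta> * d"
    and \<delta>: "2 / (p * T) \<le> \<delta>" "48 * T / (p * \<eta> * d) \<le> \<delta>"
    and "i \<le> l"
  shows "rand_avg (1 - (1 - p) ^ i) (c ` edges G) (\<lambda>C. of_bool
      (2 * card (reach G c W K x i C) \<le> card (verts G) \<and>
       real (card (reach G c W K x i C)) < (1 + \<eta> / 4) ^ i)) \<le> i * \<delta>"
  using \<open>i \<le> l\<close>
proof (induction i)
  case 0
  have "\<not> card (reach G c W K x 0 C) < 1" for C
    using start_in_reach[of x G c W K 0 C] finite_subset[OF reach_subset_verts[OF G x(1)], of c W K 0 C] G
    by (auto simp: simple_graph_def card_gt_0_iff)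
  then have "(\<lambda>C. of_bool
      (2 * card (reach G c W K x 0 C) \<le> card (verts G) \<and>
       real (card (reach G c W K x 0 C)) < (1 + \<eta> / 4) ^ 0)) = (\<lambda>C. 0 :: real)"
    by (auto simp: fun_eq_iff)
  then show ?case using finite_edges[OF G] by simp
next
  case (Suc i)
  define F where "F = c ` edges G"
  define R where "R i C = reach G c W K x i C" for i C
  define bad :: "nat \<Rightarrow> 'b set \<Rightarrow> bool" where
    "bad i C \<longleftrightarrow> 2 * card (R i C) \<le> card (verts G) \<and> real (card (R i C)) < (1 + \<eta> / 4) ^ i" for i C
  have finF: "finite F" using finite_edges[OF G] by (simp add: F_def)
  have finV: "finite (verts G)" using G by (simp add: simple_graph_def)
  have RV: "R i C \<subseteq> verts G" for i C unfolding R_def by (rule reach_subset_verts[OF G x(1)])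
  have \<delta>0: "0 \<le> \<delta>" using \<delta>(1) par by (intro order.trans[OF _ \<delta>(1)]) simp
  have q: "0 \<le> 1 - (1 - p) ^ i" "1 - (1 - p) ^ i \<le> 1"
    using par by (auto intro: power_le_one)
  \<comment> \<open>With \<open>C\<close> fixed: if \<open>C\<close> is already bad, the bound is
    trivial; past one half, monotonicity preserves success; otherwise one growth step
    applies.\<close>
  have step: "rand_avg p F (\<lambda>Q. of_bool (bad (Suc i) (C \<union> Q))) \<le> of_bool (bad i C) + \<delta>" for C
  proof -
    have le_const: "rand_avg p F (\<lambda>Q. of_bool (bad (Suc i) (C \<union> Q))) \<le> k"
      if "\<And>Q. of_bool (bad (Suc i) (C \<union> Q)) \<le> k" for k
      using rand_avg_mono[of p F "\<lambda>Q. of_bool (bad (Suc i) (C \<union> Q))" "\<lambda>_. k"] that par finF by simp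
    consider "bad i C" | "\<not> bad i C" "2 * card (R i C) > card (verts G)"
      | "2 * card (R i C) \<le> card (verts G)" "(1 + \<eta> / 4) ^ i \<le> real (card (R i C))"
      unfolding bad_def by linarith
    then show ?thesis
    proof cases
      case 1
      have "rand_avg p F (\<lambda>Q. of_bool (bad (Suc i) (C \<union> Q))) \<le> 1" by (rule le_const) simp
      then show ?thesis using 1 \<delta>0 by simp
    next
      case 2
      have "\<not> bad (Suc i) (C \<union> Q)" for Q
      proof -
        have "card (R i C) \<le> card (R (Suc i) (C \<union> Q))"
          using finite_subset[OF RV finV] unfolding R_def by (intro card_mono reach_mono) auto
        then show ?thesis using 2 by (simp add: bad_def)
      qed
      then have "rand_avg p F (\<lambda>Q. of_bool (bad (Suc i) (C \<union> Q))) \<le> 0" by (intro le_const) simp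
      then show ?thesis using \<delta>0 by simp
    next
      case 3
      obtain Fb where Fb: "\<And>v. v \<in> R i C \<Longrightarrow> finite (Fb v) \<and> card (Fb v) \<le> i + card K"
        "\<And>Q. nbrs_via G c W Fb (R i C) Q \<subseteq> R (Suc i) (C \<union> Q)"
        unfolding R_def using reach_extend[OF G x(2) fin(2)] by blast
      have "rand_avg p F (\<lambda>Q. of_bool (bad (Suc i) (C \<union> Q)))
         \<le> rand_avg p F (\<lambda>Q. of_bool (real (card (R i C \<union> nbrs_via G c W Fb (R i C) Q)) < (1 + \<eta> / 4) * card (R i C)))"
      proof (rule rand_avg_mono)
        fix Q
        have "card (R i C \<union> nbrs_via G c W Fb (R i C) Q) \<le> card (R (Suc i) (C \<union> Q))"
          using Fb(2) finite_subset[OF RV finV] reach_mono[of i "Suc i" C "C \<union> Q" G c W K x]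
          by (intro card_mono) (auto simp: R_def)
        moreover have "(1 + \<eta> / 4) ^ Suc i \<le> (1 + \<eta> / 4) * card (R i C)"
          using 3 par by simp
        ultimately have "bad (Suc i) (C \<union> Q) \<Longrightarrow> real (card (R i C \<union> nbrs_via G c W Fb (R i C) Q)) < (1 + \<eta> / 4) * card (R i C)"
          unfolding bad_def by linarith
        then show "of_bool (bad (Suc i) (C \<union> Q))
          \<le> (of_bool (real (card (R i C \<union> nbrs_via G c W Fb (R i C) Q)) < (1 + \<eta> / 4) * card (R i C)) :: real)"
          by (simp add: of_bool_def)
      qed (use par in auto)
      also have "\<dots> \<le> \<delta>"
        unfolding F_def
      proof (rule random_colours_expand[OF G col ex par RV _ 3(1) _ fin(1) _ D(2) \<delta>])
        show "R i C \<noteq> {}" using start_in_reach[of x G c W K i C] by (auto simp: R_def)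
        show "i + card K + card W \<le> D" using D(1) Suc.prems by simp
      qed (use Fb in auto)
      finally show ?thesis by simp
    qed
  qed
  have "rand_avg (1 - (1 - p) ^ Suc i) F (\<lambda>C. of_bool (bad (Suc i) C))
    = rand_avg ((1 - (1 - p) ^ i) + p - (1 - (1 - p) ^ i) * p) F (\<lambda>C. of_bool (bad (Suc i) C))"
    by (simp add: algebra_simps)
  also have "\<dots> = rand_avg (1 - (1 - p) ^ i) F (\<lambda>C. rand_avg p F (\<lambda>Q. of_bool (bad (Suc i) (C \<union> Q))))"
    by (rule rand_avg_union[OF finF])
  also have "\<dots> \<le> rand_avg (1 - (1 - p) ^ i) F (\<lambda>C. of_bool (bad i C) + \<delta>)"
    using q step by (intro rand_avg_mono) auto
  also have "\<dots> \<le> i * \<delta> + \<delta>"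
    using Suc finF by (simp add: rand_avg_add bad_def R_def F_def)
  finally show ?case by (simp add: bad_def R_def F_def algebra_simps)
qed

text \<open>Each side fails to pass half of the vertices with probability at most 1/4, so some
  \<open>C\<close> serves both. The reached sets then share a vertex, and the two witnesses have at
  most \<open>l\<close> edges each, with colours in \<open>C\<close> and in
  \<open>F - C\<close>.\<close>

lemma rainbow_connection:
  fixes d \<eta> \<epsilon> :: real and l :: nat
  assumes G: "simple_graph G" and col: "proper_edge_colouring G c" and ex: "expander d \<eta> \<epsilon> G"
    and par: "\<epsilon> \<le> 1/8" "0 < \<eta>" "\<eta> < 1" "0 < d" "0 < l"
    and l: "card (verts G) \<le> (1 + \<eta> / 4) ^ l" "6144 * real l ^ 4 \<le> \<eta> * d"
    and xy: "x \<in> verts G" "y \<in> verts G" "x \<notin> W" "y \<notin> W" and fin: "finite W" "finite K"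
    and D: "8 * real (l + card K + card W) \<le> \<eta> * d"
  shows "\<exists>p. is_path G p \<and> hd p = x \<and> last p = y \<and> inj_on c (path_edges p) \<and>
    c ` path_edges p \<inter> K = {} \<and> set p \<inter> W = {} \<and> length p \<le> Suc (2 * l)"
proof -
  define F where "F = c ` edges G"
  have finF: "finite F" and finV: "finite (verts G)" and finE: "finite (edges G)"
    using finite_edges[OF G] G by (auto simp: F_def simple_graph_def)
  \<comment> \<open>Chosen so that \<open>l\<close> rounds of density \<open>p\<close> make up one
    uniformly random set.\<close>
  define p where "p = 1 - root l (1/2)"
  have p: "(1 - p) ^ l = 1/2" "0 < p" "p \<le> 1"
    using par by (auto simp: p_def)
  \<comment> \<open>Bernoulli's inequality gives (1 - 1/(2l))^l \<ge> 1/2 = (1 - p)^l.\<close>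
  have p_ge: "1 / (2 * real l) \<le> p"
  proof -
    have "1 + real l * (- 1 / (2 * real l)) \<le> (1 + - 1 / (2 * real l)) ^ l"
      using par by (intro Bernoulli_inequality) (simp add: field_simps)
    moreover have "1 + real l * (- 1 / (2 * real l)) = 1/2" using par by simp
    ultimately have "(1 - p) ^ l \<le> (1 - 1 / (2 * real l)) ^ l" unfolding p(1) by simp
    moreover have "0 \<le> 1 - p" "0 \<le> 1 - 1 / (2 * real l)" using p par by (auto simp: field_simps)
    ultimately have "1 - p \<le> 1 - 1 / (2 * real l)"
      using par(5) by (metis power_mono_iff)
    then show ?thesis by simp
  qed
  \<comment> \<open>As p \<ge> 1/(2l), this \<open>T\<close> gives 2/(pT) \<le> 1/(4l), and 48T/(p
    \<eta> d) \<le> 1536 l^3/(\<eta> d) \<le> 1/(4l) follows from 6144 l^4 \<le> \<eta> d. Over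
    \<open>l\<close> rounds the failures add up to 1/4.\<close>
  define T where "T = 16 * real l ^ 2"
  define \<delta> where "\<delta> = 1 / (4 * real l)"
  have T: "0 < T" using par by (simp add: T_def)
  have "1 \<le> 2 * real l * p" using p_ge par by (simp add: field_simps)
  have \<delta>1: "2 / (p * T) \<le> \<delta>"
  proof -
    have "8 * real l * 1 \<le> 8 * real l * (2 * real l * p)" using \<open>1 \<le> 2 * real l * p\<close> by (intro mult_left_mono) auto
    then show ?thesis using par p by (simp add: T_def \<delta>_def field_simps power2_eq_square)
  qed
  have \<delta>2: "48 * T / (p * \<eta> * d) \<le> \<delta>"
  proof -
    have "6144 * real l ^ 4 * 1 \<le> (\<eta> * d) * (2 * real l * p)"
      using \<open>1 \<le> 2 * real l * p\<close> par by (intro mult_mono[OF l(2)]) auto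
    then have "2 * real l * (3072 * real l ^ 3) \<le> 2 * real l * (p * \<eta> * d)"
      by (simp add: algebra_simps power_numeral_reduce)
    then have "3072 * real l ^ 3 \<le> p * \<eta> * d" using par by (simp add: mult_ac)
    then show ?thesis using par p by (simp add: T_def \<delta>_def field_simps power_numeral_reduce)
  qed
  have half: "rand_avg (1/2) F (\<lambda>C. of_bool (2 * card (reach G c W K z l C) \<le> card (verts G))) \<le> 1/4"
    if z: "z \<in> verts G" "z \<notin> W" for z
  proof -
    \<comment> \<open>A set of at most half of the vertices has fewer than n \<le> (1 + \<eta>/4)^l
      elements, so being bad after \<open>l\<close> rounds just means not passing one half.\<close>
    have "(\<lambda>C. of_bool (2 * card (reach G c W K z l C) \<le> card (verts G)))
      = (\<lambda>C. of_bool (2 * card (reach G c W K z l C) \<le> card (verts G) \<and>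
       real (card (reach G c W K z l C)) < (1 + \<eta> / 4) ^ l) :: real)"
    proof -
      have "0 < card (verts G)" using z finV by (auto simp: card_gt_0_iff)
      then have "2 * k \<le> card (verts G) \<Longrightarrow> real k < (1 + \<eta> / 4) ^ l" for k
        using l(1) by linarith
      then show ?thesis by (auto simp: fun_eq_iff)
    qed
    then show ?thesis
      using random_reach_large[OF G col ex par(1-4) p(2,3) T z fin order.refl D \<delta>1 \<delta>2 order.refl] p(1) par
      by (simp add: F_def \<delta>_def)
  qed
  have "\<exists>C\<subseteq>F. 2 * card (reach G c W K x l C) > card (verts G) \<and>
     2 * card (reach G c W K y l (F - C)) > card (verts G)"
  proof (rule ccontr)
    assume "\<not> ?thesis"
    then have *: "2 * card (reach G c W K x l C) \<le> card (verts G) \<or>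
     2 * card (reach G c W K y l (F - C)) \<le> card (verts G)" if "C \<subseteq> F" for C
      using that by (meson not_le)
    have "1 = rand_avg (1/2) F (\<lambda>C. 1)" using finF by simp
    also have "\<dots> \<le> rand_avg (1/2) F (\<lambda>C. of_bool (2 * card (reach G c W K x l C) \<le> card (verts G)) +
       of_bool (2 * card (reach G c W K y l (F - C)) \<le> card (verts G)))"
      using * by (intro rand_avg_mono) (auto simp: of_bool_def)
    also have "\<dots> \<le> 1/4 + 1/4"
      using half[OF xy(1,3)] half[OF xy(2,4)]
        rand_avg_compl[OF finF, of "\<lambda>C. of_bool (2 * card (reach G c W K y l C) \<le> card (verts G))"]
      by (simp add: rand_avg_add)
    finally show False by simp
  qed
  then obtain C where C: "2 * card (reach G c W K x l C) > card (verts G)"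
     "2 * card (reach G c W K y l (F - C)) > card (verts G)" by auto
  have "reach G c W K x l C \<inter> reach G c W K y l (F - C) \<noteq> {}"
  proof
    let ?A = "reach G c W K x l C" and ?B = "reach G c W K y l (F - C)"
    assume "?A \<inter> ?B = {}"
    moreover have sub: "?A \<subseteq> verts G" "?B \<subseteq> verts G" by (intro reach_subset_verts[OF G] xy)+
    ultimately have "card ?A + card ?B = card (?A \<union> ?B)"
      using finV by (intro card_Un_disjoint[symmetric]) (auto intro: finite_subset)
    also have "\<dots> \<le> card (verts G)" using sub finV by (intro card_mono) auto
    finally show False using C by simp
  qed
  then obtain v E1 E2 where
    E1: "E1 \<subseteq> edges G" "card E1 \<le> l" "inj_on c E1" "c ` E1 \<subseteq> C - K" "\<Union>E1 \<inter> W = {}" "linked E1 x v"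
    and E2: "E2 \<subseteq> edges G" "card E2 \<le> l" "inj_on c E2" "c ` E2 \<subseteq> F - C - K" "\<Union>E2 \<inter> W = {}" "linked E2 y v"
    unfolding reach_def by auto
  have inj: "inj_on c (E1 \<union> E2)"
    using E1 E2 unfolding inj_on_Un by fastforce
  have "linked (E1 \<union> E2) x v" "linked (E1 \<union> E2) v y"
    using E1 E2 by (auto intro: linked_mono linked_sym)
  then obtain p where p: "p \<noteq> []" "hd p = x" "last p = y" "distinct p" "path_edges p \<subseteq> E1 \<union> E2"
    using linked_imp_path linked_trans by metis
  have setp: "set p \<subseteq> insert x (\<Union>(E1 \<union> E2))"
    using set_path_subset[OF p(1)] Union_mono[OF p(5)] p(2) by blast
  have "card (path_edges p) \<le> card (E1 \<union> E2)"
    using p E1 E2 finE by (intro card_mono) (auto intro: finite_subset)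
  also have "\<dots> \<le> card E1 + card E2" by (rule card_Un_le)
  finally have "length p \<le> Suc (2 * l)"
    using length_le_card_path_edges[OF p(4)] E1 E2 by linarith
  moreover have "is_path G p" unfolding is_path_def
  proof (intro conjI)
    show "set p \<subseteq> verts G" using setp E1(1) E2(1) xy G by (fastforce simp: simple_graph_def)
  qed (use p E1 E2 in auto)
  moreover have "set p \<inter> W = {}"
  proof -
    have "insert x (\<Union>(E1 \<union> E2)) \<inter> W = {}" using E1(5) E2(5) xy(3) by auto
    then show ?thesis using setp by auto
  qed
  moreover have "c ` path_edges p \<inter> K = {}"
  proof -
    have "c ` (E1 \<union> E2) \<inter> K = {}" using E1(4) E2(4) by auto
    then show ?thesis using image_mono[OF p(5), of c] by blast
  qed
  moreover have "inj_on c (path_edges p)" using inj p(5) by (rule inj_on_subset)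
  ultimately show ?thesis using p by blast
qed

section \<open>Subdivisions\<close>

lemma card_vertex_pairs_le:
  assumes "finite Z"
  shows "finite (vertex_pairs Z)" "card (vertex_pairs Z) \<le> card Z ^ 2"
proof -
  have sub: "vertex_pairs Z \<subseteq> (\<lambda>(a, b). {a, b}) ` (Z \<times> Z)"
    by (auto simp: vertex_pairs_def card_2_iff image_iff)
  then show "finite (vertex_pairs Z)" using assms by (auto intro: finite_subset)
  have "card (vertex_pairs Z) \<le> card (Z \<times> Z)"
    using assms sub by (intro surj_card_le) auto
  then show "card (vertex_pairs Z) \<le> card Z ^ 2"
    by (simp add: card_cartesian_product power2_eq_square)
qed

text \<open>The pairs are joined one after another. Each earlier path blocks at most
  \<open>2 * l\<close> colours and \<open>2 * l\<close> vertices, whence the term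
  \<open>4 * l * k\<close>; as \<open>k\<close> bounds the final number of pairs, this budget stays
  fixed during the induction.\<close>

lemma rainbow_linkage:
  fixes d \<eta> \<epsilon> :: real and l :: nat
  assumes G: "simple_graph G" and col: "proper_edge_colouring G c" and ex: "expander d \<eta> \<epsilon> G"
    and par: "\<epsilon> \<le> 1/8" "0 < \<eta>" "\<eta> < 1" "0 < d" "0 < l"
    and l: "card (verts G) \<le> (1 + \<eta> / 4) ^ l" "6144 * real l ^ 4 \<le> \<eta> * d"
    and Z: "Z \<subseteq> verts G" and A: "finite A" "A \<subseteq> vertex_pairs Z" "card A \<le> k"
    and D: "8 * real (l + card Z + 4 * l * k) \<le> \<eta> * d"
  shows "\<exists>P. (\<forall>e\<in>A. is_path G (P e) \<and> {hd (P e), last (P e)} = e \<and>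
        path_interior (P e) \<inter> Z = {} \<and> length (P e) \<le> Suc (2 * l)) \<and>
      (\<forall>e\<in>A. \<forall>f\<in>A. e \<noteq> f \<longrightarrow> path_interior (P e) \<inter> path_interior (P f) = {}) \<and>
      inj_on c (\<Union>e\<in>A. path_edges (P e))"
  using A
proof (induction A rule: finite_induct)
  case (insert e A)
  then have cA: "A \<subseteq> vertex_pairs Z" "card A \<le> k" by auto
  obtain P where P': "\<forall>f\<in>A. is_path G (P f) \<and> {hd (P f), last (P f)} = f \<and>
        path_interior (P f) \<inter> Z = {} \<and> length (P f) \<le> Suc (2 * l)"
    "\<forall>f\<in>A. \<forall>g\<in>A. f \<noteq> g \<longrightarrow> path_interior (P f) \<inter> path_interior (P g) = {}"
    "inj_on c (\<Union>f\<in>A. path_edges (P f))"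
    using insert.IH[OF cA] by (elim exE conjE)
  note P = P'(1)[rule_format] P'(2)[rule_format] P'(3)
  have finZ: "finite Z" using G Z by (auto simp: simple_graph_def intro: finite_subset)
  obtain x y where e: "e = {x, y}" "x \<noteq> y" "x \<in> Z" "y \<in> Z"
    using insert.prems by (auto simp: vertex_pairs_def card_2_iff)
  define K where "K = c ` (\<Union>f\<in>A. path_edges (P f))"
  define W where "W = (Z \<union> (\<Union>f\<in>A. path_interior (P f))) - {x, y}"
  have fin: "finite K" "finite W" using insert.hyps finZ by (auto simp: K_def W_def path_interior_def)
  have each: "card (path_edges (P f)) \<le> 2 * l" "card (path_interior (P f)) \<le> 2 * l" if "f \<in> A" for f
  proof -
    have len: "length (P f) \<le> Suc (2 * l)" and ne: "P f \<noteq> []" using P(1)[OF that] by (auto simp: is_path_def)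
    have "path_edges (P f) = (\<lambda>i. {P f ! i, P f ! Suc i}) ` {..<length (P f) - 1}"
      by (auto simp: path_edges_def)
    then show "card (path_edges (P f)) \<le> 2 * l"
      using len card_image_le[of "{..<length (P f) - 1}" "\<lambda>i. {P f ! i, P f ! Suc i}"] by simp
    show "card (path_interior (P f)) \<le> 2 * l"
      unfolding path_interior_def using card_length[of "butlast (tl (P f))"] len by simp
  qed
  have "card K \<le> card (\<Union>f\<in>A. path_edges (P f))"
    unfolding K_def using insert.hyps by (intro card_image_le) auto
  also have "\<dots> \<le> (\<Sum>f\<in>A. card (path_edges (P f)))" using insert.hyps by (intro card_UN_le)
  also have "\<dots> \<le> (\<Sum>f\<in>A. 2 * l)" using each by (intro sum_mono)
  also have "\<dots> \<le> 2 * l * k" using cA(2) by simp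
  finally have K: "card K \<le> 2 * l * k" .
  have "card (\<Union>f\<in>A. path_interior (P f)) \<le> (\<Sum>f\<in>A. card (path_interior (P f)))"
    using insert.hyps by (intro card_UN_le)
  also have "\<dots> \<le> (\<Sum>f\<in>A. 2 * l)" using each by (intro sum_mono)
  also have "\<dots> \<le> 2 * l * k" using cA(2) by simp
  finally have "card (Z \<union> (\<Union>f\<in>A. path_interior (P f))) \<le> card Z + 2 * l * k"
    using card_Un_le[of Z "\<Union>f\<in>A. path_interior (P f)"] by linarith
  moreover have "card W \<le> card (Z \<union> (\<Union>f\<in>A. path_interior (P f)))"
    unfolding W_def using insert.hyps finZ by (intro card_mono) (auto simp: path_interior_def)
  ultimately have "l + card K + card W \<le> l + card Z + 4 * l * k" using K by linarith
  then have "real (l + card K + card W) \<le> real (l + card Z + 4 * l * k)" by (rule of_nat_mono)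
  then have D': "8 * real (l + card K + card W) \<le> \<eta> * d"
    by (intro order.trans[OF mult_left_mono D]) simp_all
  have xyV: "x \<in> verts G" "y \<in> verts G" using e Z by auto
  have xyW: "x \<notin> W" "y \<notin> W" by (auto simp: W_def)
  obtain p where p: "is_path G p" "hd p = x" "last p = y" "inj_on c (path_edges p)"
    "c ` path_edges p \<inter> K = {}" "set p \<inter> W = {}" "length p \<le> Suc (2 * l)"
    using rainbow_connection[OF G col ex par l xyV xyW fin(2,1) D'] by auto
  \<comment> \<open>\<open>W\<close> omits only \<open>x\<close> and \<open>y\<close>, which are the
    ends of \<open>p\<close>; so the interior avoids all roots and all earlier interiors.\<close>
  have int: "path_interior p \<subseteq> set p - {x, y}"
    using path_interior_subset[of p] p(1-3) e(2) by (auto simp: is_path_def)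
  have intZ: "path_interior p \<inter> Z = {}" using int p(6) by (auto simp: W_def)
  have intP: "path_interior p \<inter> path_interior (P f) = {}" if "f \<in> A" for f
    using int p(6) that by (auto simp: W_def)
  have [simp]: "f \<in> A \<Longrightarrow> f \<noteq> e" for f using insert.hyps by auto
  have UN: "(\<Union>f\<in>insert e A. path_edges ((P(e := p)) f)) = path_edges p \<union> (\<Union>f\<in>A. path_edges (P f))"
    by auto
  have inj: "inj_on c (path_edges p \<union> (\<Union>f\<in>A. path_edges (P f)))"
    using p(4) P(3) p(5) unfolding inj_on_Un K_def by blast
  show ?case
  proof (intro exI[of _ "P(e := p)"] conjI ballI impI)
    show "inj_on c (\<Union>f\<in>insert e A. path_edges ((P(e := p)) f))" unfolding UN by (rule inj)
  next
    fix f g assume "f \<in> insert e A" "g \<in> insert e A" "f \<noteq> g"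
    then show "path_interior ((P(e := p)) f) \<inter> path_interior ((P(e := p)) g) = {}"
      using P(2)[of f g] intP[of f] intP[of g] by (auto simp: Int_commute)
  next
    fix f assume f: "f \<in> insert e A"
    show "is_path G ((P(e := p)) f)" "{hd ((P(e := p)) f), last ((P(e := p)) f)} = f"
      "path_interior ((P(e := p)) f) \<inter> Z = {}" "length ((P(e := p)) f) \<le> Suc (2 * l)"
      using f P(1)[of f] p e intZ by auto
  qed
qed simp

lemma rooted_subdivision_of_paths:
  fixes P :: "'a set \<Rightarrow> 'a list"
  assumes G: "simple_graph G" and Z: "Z \<subseteq> verts G"
    and P: "\<And>e. e \<in> vertex_pairs Z \<Longrightarrow> is_path G (P e) \<and> {hd (P e), last (P e)} = e \<and>
        path_interior (P e) \<inter> Z = {}"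
    and disj: "\<And>e f. e \<in> vertex_pairs Z \<Longrightarrow> f \<in> vertex_pairs Z \<Longrightarrow> e \<noteq> f \<Longrightarrow>
        path_interior (P e) \<inter> path_interior (P f) = {}"
  defines "H \<equiv> \<lparr>verts = Z \<union> (\<Union>e\<in>vertex_pairs Z. set (P e)), edges = (\<Union>e\<in>vertex_pairs Z. path_edges (P e))\<rparr>"
  shows "subgraph H G" "rooted_subdivision Z P H"
proof -
  have vH: "verts H = Z \<union> (\<Union>e\<in>vertex_pairs Z. set (P e))"
    and eH: "edges H = (\<Union>e\<in>vertex_pairs Z. path_edges (P e))" by (simp_all add: H_def)
  have sub: "verts H \<subseteq> verts G" "edges H \<subseteq> edges G"
    using P Z unfolding vH eH by (fastforce simp: is_path_def)+
  have "simple_graph H" unfolding simple_graph_def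
  proof (intro conjI ballI)
    show "finite (verts H)" using sub(1) G by (auto simp: simple_graph_def intro: finite_subset)
    fix e assume e: "e \<in> edges H"
    then show "card e = 2" using sub(2) G by (auto simp: simple_graph_def)
    show "e \<subseteq> verts H" using e path_edges_subset_Pow unfolding eH vH by fastforce
  qed
  then show "subgraph H G" using sub by (simp add: subgraph_def)
  show "rooted_subdivision Z P H" unfolding rooted_subdivision_def
  proof (intro conjI ballI impI)
    fix e assume e: "e \<in> vertex_pairs Z"
    then show "is_path H (P e)" using P[OF e] by (auto simp: is_path_def vH eH)
    show "{hd (P e), last (P e)} = e" "path_interior (P e) \<inter> Z = {}" using P[OF e] by auto
  qed (use disj vH eH in auto)
qed

section \<open>Numerical parameters and assembly\<close>

lemma theorem28_parameters:
  fixes n m :: nat and L d \<mu> \<eta> :: real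
  assumes n: "n \<ge> 2" and mu: "\<mu> \<ge> 2" and m: "m \<ge> 2" and \<eta>: "0 < \<eta>" "\<eta> < 1"
    and L: "L = 2^10 * log 2 (real n) / \<eta>^2"
    and d: "d \<ge> 2^135 * real m^8 * \<mu>^9 * (log 2 (real n))^7 / \<eta>^14"
  obtains l :: nat where "0 < l" "n \<le> (1 + \<eta> / 4) ^ l" "6144 * real l ^ 4 \<le> \<eta> * d"
    "8 * real (l + m + 4 * l * m\<^sup>2) \<le> \<eta> * d" "2 * real l \<le> L"
proof -
  define t where "t = log 2 (real n)"
  \<comment> \<open>By Bernoulli, \<open>r\<close> growth steps double the size, as r \<eta>/4 \<ge>
    1, and \<open>s\<close> doublings reach \<open>n\<close>. Their product \<open>l\<close> is of
    order log n / \<eta>.\<close>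
  define r s where "r = nat \<lceil>4 / \<eta>\<rceil>" and "s = nat \<lceil>t\<rceil>"
  have t: "1 \<le> t" using n log_le_cancel_iff[of 2 2 "real n"] by (simp add: t_def)
  have r: "4 / \<eta> \<le> r" "r \<le> 4 / \<eta> + 1" and s: "t \<le> s" "s \<le> t + 1"
    using \<eta> t by (simp_all add: r_def s_def)
  have r_le: "r \<le> 5 / \<eta>" using r(2) \<eta> by (simp add: field_simps)
  have s_le: "s \<le> 2 * t" using s t by linarith
  have r0: "0 < r" using r \<eta> by (smt (verit) divide_pos_pos gr0I of_nat_0)
  have s0: "0 < s" using s t by (cases s) auto
  define l where "l = r * s"
  have l0: "0 < l" using r0 s0 by (simp add: l_def)
  have "real l \<le> 5 / \<eta> * (2 * t)"
    unfolding l_def of_nat_mult using r_le s_le \<eta> by (intro mult_mono) auto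
  then have l_le: "real l \<le> 10 * (t / \<eta>)" by simp
  define u where "u = t / \<eta>"
  have u: "1 \<le> u" "real l \<le> 10 * u" "t \<le> u" "1 / \<eta> \<le> u"
    using t \<eta> l_le by (auto simp: u_def field_simps intro: order.trans[of _ 1])
  have grow: "n \<le> (1 + \<eta> / 4) ^ l"
  proof -
    have "2 \<le> 1 + real r * (\<eta> / 4)" using r(1) \<eta> by (simp add: field_simps)
    also have "\<dots> \<le> (1 + \<eta> / 4) ^ r" using \<eta> by (intro Bernoulli_inequality) auto
    finally have "2 ^ s \<le> ((1 + \<eta> / 4) ^ r) ^ s" by (intro power_mono) auto
    moreover have "real n = 2 powr t" using n by (simp add: t_def)
    moreover have "2 powr t \<le> 2 powr s" using s by simp
    ultimately show ?thesis by (simp add: l_def power_mult powr_realpow)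
  qed
  have m1: "1 \<le> real m" using m by simp
  \<comment> \<open>Common target of the next two estimates: m^2 u^4 is raised to m^8 u^7, then
    \<eta>^13 \<le> \<eta>^7 is used, and the fourteenth factor 1/\<eta> is absorbed by the product
    \<eta> d.\<close>
  have big: "2^135 * real m ^ 2 * u ^ 4 \<le> \<eta> * d"
  proof -
    have "2^135 * real m ^ 2 * u ^ 4 \<le> 2^135 * real m ^ 8 * u ^ 7"
      using m1 u by (intro mult_mono power_increasing) auto
    also have "\<dots> \<le> 2^135 * real m ^ 8 * (t ^ 7 / \<eta> ^ 13)"
    proof -
      have "\<eta> ^ 13 \<le> \<eta> ^ 7" using \<eta> by (intro power_decreasing) auto
      then have "u ^ 7 \<le> t ^ 7 / \<eta> ^ 13"
        unfolding u_def power_divide using \<eta> t by (intro divide_left_mono) auto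
      then show ?thesis by (intro mult_left_mono) auto
    qed
    also have "\<dots> \<le> 2^135 * real m ^ 8 * \<mu>^9 * (t ^ 7 / \<eta> ^ 13)"
    proof -
      have "1 \<le> \<mu> ^ 9" using mu by (intro one_le_power) auto
      then have "2^135 * real m ^ 8 * 1 \<le> 2^135 * real m ^ 8 * \<mu>^9" by (intro mult_left_mono) auto
      then show ?thesis using t \<eta> by (intro mult_right_mono) auto
    qed
    also have "\<dots> = \<eta> * (2^135 * real m ^ 8 * \<mu>^9 * t ^ 7 / \<eta> ^ 14)"
      using \<eta> by (simp add: power_numeral_reduce)
    also have "\<dots> \<le> \<eta> * d" using d \<eta> unfolding t_def by (intro mult_left_mono) auto
    finally show ?thesis .
  qed
  have l4: "6144 * real l ^ 4 \<le> \<eta> * d"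
  proof -
    have "real l ^ 4 \<le> (10 * u) ^ 4" using u by (intro power_mono) auto
    then have "6144 * real l ^ 4 \<le> 61440000 * 1 * u ^ 4" by (simp add: power_mult_distrib)
    also have "\<dots> \<le> 2^135 * real m ^ 2 * u ^ 4"
      using m1 u by (intro mult_mono) auto
    finally show ?thesis using big by linarith
  qed
  have l1: "8 * real (l + m + 4 * l * m\<^sup>2) \<le> \<eta> * d"
  proof -
    have m2: "real m \<le> real m ^ 2" "1 \<le> real m ^ 2"
      using self_le_power[OF m1, of 2] one_le_power[OF m1, of 2] by auto
    have "l \<le> real m ^ 2 * l" using mult_right_mono[OF m2(2), of "real l"] by simp
    moreover have "m \<le> real m ^ 2 * l" using mult_mono[OF m2(1), of 1 "real l"] l0 by simp
    \<comment> \<open>Here 48 = 8 (1 + 1 + 4), as \<open>l\<close> and \<open>m\<close> are each at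
      most m^2 l.\<close>
    ultimately have "8 * real (l + m + 4 * l * m\<^sup>2) \<le> 48 * (real m ^ 2 * l)"
      by (simp add: mult_ac)
    also have "\<dots> \<le> 48 * (real m ^ 2 * (10 * u))" using u by (intro mult_left_mono) auto
    also have "\<dots> \<le> 480 * real m ^ 2 * u ^ 4"
      using u by (simp add: self_le_power mult_left_mono)
    also have "\<dots> \<le> 2^135 * real m ^ 2 * u ^ 4" using u by (intro mult_right_mono) auto
    finally show ?thesis using big by linarith
  qed
  have "2 * real l \<le> L"
  proof -
    have "\<eta> ^ 2 \<le> \<eta> ^ 1" using \<eta> by (intro power_decreasing) auto
    then have "t / \<eta> \<le> t / \<eta> ^ 2" using \<eta> t by (intro divide_left_mono) auto
    then show ?thesis using l_le t \<eta> unfolding L t_def[symmetric] by simp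
  qed
  then show ?thesis using that l0 grow l4 l1 by blast
qed

theorem theorem28:
  fixes G :: "'a ugraph" and c :: "'a set \<Rightarrow> 'c" and Z :: "'a set"
    and n m :: nat and L d \<mu> \<eta> \<epsilon> :: real
  assumes "n \<ge> 2" and "L \<ge> 2" and "d \<ge> 2" and "\<mu> \<ge> 2" and "m \<ge> 2"
    and "0 < \<eta>" and "\<eta> < 1"
    and "0 < \<epsilon>" and "\<epsilon> \<le> 1/8"
    and "L = 2^10 * log 2 (real n) / \<eta>^2"
    and "d \<ge> 2^135 * real m^8 * \<mu>^9 * (log 2 (real n))^7 / \<eta>^14"
    and "simple_graph G" and "card (verts G) = n"
    and "bipartite G"
    and "expander d \<eta> \<epsilon> G"
    and "proper_edge_colouring G c"
    and "real (max_degree G) \<le> \<mu> * d"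
    and "Z \<subseteq> verts G" and "card Z = m"
  shows "\<exists>H P. subgraph H G \<and> rooted_subdivision Z P H \<and> rainbow c H \<and>
           (\<forall>e\<in>vertex_pairs Z. real (card (path_interior (P e))) \<le> L)"
proof -
  obtain l where l: "0 < l" "n \<le> (1 + \<eta> / 4) ^ l" "6144 * real l ^ 4 \<le> \<eta> * d"
    "8 * real (l + m + 4 * l * m\<^sup>2) \<le> \<eta> * d" "2 * real l \<le> L"
    using theorem28_parameters assms(1,4,5,6,7,10,11) by metis
  \<comment> \<open>An infinite \<open>Z\<close> would have \<open>card Z = 0\<close>, contradicting
    m \<ge> 2.\<close>
  have finZ: "finite Z" using assms(5,19) by (cases "finite Z") auto
  have pairs: "finite (vertex_pairs Z)" "card (vertex_pairs Z) \<le> m\<^sup>2"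
    using card_vertex_pairs_le[OF finZ] assms(19) by auto
  have d: "0 < d" using assms(3) by simp
  have n: "card (verts G) \<le> (1 + \<eta> / 4) ^ l" using l(2) assms(13) by simp
  have D: "8 * real (l + card Z + 4 * l * m\<^sup>2) \<le> \<eta> * d" using l(4) assms(19) by simp
  obtain P where P': "\<forall>e\<in>vertex_pairs Z. is_path G (P e) \<and> {hd (P e), last (P e)} = e \<and>
        path_interior (P e) \<inter> Z = {} \<and> length (P e) \<le> Suc (2 * l)"
    "\<forall>e\<in>vertex_pairs Z. \<forall>f\<in>vertex_pairs Z. e \<noteq> f \<longrightarrow>
        path_interior (P e) \<inter> path_interior (P f) = {}"
    "inj_on c (\<Union>e\<in>vertex_pairs Z. path_edges (P e))"
    using rainbow_linkage[OF assms(12,16,15,9,6,7) d l(1) n l(3) assms(18) pairs(1) order.refl pairs(2) D]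
    by (elim exE conjE)
  note P = P'(1)[rule_format] P'(2)[rule_format] P'(3)
  define H where "H = \<lparr>verts = Z \<union> (\<Union>e\<in>vertex_pairs Z. set (P e)),
    edges = (\<Union>e\<in>vertex_pairs Z. path_edges (P e))\<rparr>"
  have "subgraph H G" "rooted_subdivision Z P H"
    unfolding H_def using P by (intro rooted_subdivision_of_paths[OF assms(12,18)]; blast)+
  moreover have "rainbow c H" using P(3) by (simp add: rainbow_def H_def)
  moreover have "real (card (path_interior (P e))) \<le> L" if "e \<in> vertex_pairs Z" for e
  proof -
    have "card (path_interior (P e)) \<le> length (P e) - 2"
      unfolding path_interior_def using card_length[of "butlast (tl (P e))"] by simp
    then have "card (path_interior (P e)) \<le> 2 * l" using P(1)[OF that] by linarith
    then show ?thesis using l(5) by linarith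
  qed
  ultimately show ?thesis by blast
qed

end
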